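(* Let $0<\alpha<1$, $\sigma_0>0$, $\theta\geqslant 1$ and $N>0$ be real numbers. Suppose $\sigma_n^2=\sigma_0^2 n^{-\theta}$, and consider, for real $n>0$, the Bennett half width with $R=N/n$, $$H(n)=H^{\mathrm{Ben}}(n,N/n)=\sqrt{\frac{2\sigma_n^2\log(2/\alpha)}{N/n}}+\frac{\log(2/\alpha)}{3\,(N/n)}.$$ (i) If $\theta=1$, then the minimizer of $H(n)$ over $n\in[1,\infty)$ is $n_*=1$. (ii) If $\theta>1$, then the minimizer of $H(n)$ over $n\in(0,\infty)$ is $$n_*=\left(\frac{9(\theta-1)^2\,\sigma_0^2\,N}{2\log(2/\alpha)}\right)^{1/(\theta+1)}.$$
   Context: For $R$ independent identically distributed observations with values in $[0,1]$, each with variance $\sigma_n^2$ (each observation being the average of an integrand over $n$ randomized quasi-Monte Carlo points), the Bennett confidence interval at level $1-\alpha$ has half width $$H^{\mathrm{Ben}}(n,R)=\sqrt{\frac{2\sigma_n^2\log(2/\alpha)}{R}}+\frac{\log(2/\alpha)}{3R}.$$ The total number of function evaluations is $N=nR$. The problem is relaxed so that $n$ is a continuous positive variable and $R=N/n$ need not be an integer. The variance is modeled as $\sigma_n^2=\sigma_0^2n^{-\theta}$, where $\sigma_0$ and $\theta$ do not depend on $n$. Here $\log$ is the natural logarithm. *)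

theory Defs
  imports Complex_Main
begin

text \<open>
  Half width of the Bennett confidence interval at level \<open>1 - \<alpha>\<close>. The value \<open>(\<sigma> n)\<^sup>2\<close> is
  the variance of a single observation, which is an average over \<open>n\<close> randomized
  quasi-Monte Carlo points; \<open>R\<close> is the number of observations. Both \<open>n\<close> and \<open>R\<close> are real,
  since the problem is relaxed to continuous values.
\<close>

definition bennett_half_width :: "(real \<Rightarrow> real) \<Rightarrow> real \<Rightarrow> real \<Rightarrow> real \<Rightarrow> real" where
  "bennett_half_width \<sigma> \<alpha> n R = sqrt (2 * (\<sigma> n)\<^sup>2 * ln (2 / \<alpha>) / R) + ln (2 / \<alpha>) / (3 * R)"

definition is_the_minimizer_on :: "(real \<Rightarrow> real) \<Rightarrow> real set \<Rightarrow> real \<Rightarrow> bool" where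
  "is_the_minimizer_on f S x \<longleftrightarrow> (\<forall>y. is_arg_min f (\<lambda>z. z \<in> S) y \<longleftrightarrow> y = x)"

end

theory Submission
  imports Defs
begin

text \<open>
  With \<open>A = sqrt (2 * \<sigma>\<^sub>0\<^sup>2 * ln (2 / \<alpha>) / N)\<close> and \<open>B = ln (2 / \<alpha>) / (3 * N)\<close>, the half width is
  \<open>A * n powr ((1 - \<theta>) / 2) + B * n\<close>. For \<open>\<theta> = 1\<close> it is strictly increasing. For \<open>\<theta> > 1\<close> put
  \<open>p = (\<theta> - 1) / 2\<close>, let \<open>m\<close> be the critical point, \<open>B = p * A * m powr (- p - 1)\<close>, and rescale by
  \<open>t = n / m\<close>: the claim becomes \<open>1 + p < t powr (- p) + p * t\<close> for \<open>t \<noteq> 1\<close>, which follows from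
  \<open>1 + x \<le> exp x\<close> at \<open>x = - p * ln t\<close> and \<open>ln t < t - 1\<close>.
\<close>

lemma is_the_minimizer_onI:
  assumes "x \<in> S" and "\<And>y. y \<in> S \<Longrightarrow> y \<noteq> x \<Longrightarrow> f x < f y"
  shows "is_the_minimizer_on f S x"
  unfolding is_the_minimizer_on_def is_arg_min_def
  using assms by (metis less_asym less_irrefl)

lemma powr_neg_plus_linear_gt:
  fixes p t :: real
  assumes "p > 0" and "t > 0" and "t \<noteq> 1"
  shows "1 + p < t powr (- p) + p * t"
proof -
  \<comment> \<open>Strictness enters here: equality in the tangent bound for \<open>ln\<close>
    holds only at \<open>t = 1\<close>.\<close>
  have "ln t < t - 1"
    using assms ln_le_minus_one[of t] ln_eq_minus_one[of t] by linarith
  then have "p * ln t < p * (t - 1)"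
    using assms by simp
  moreover have "1 - p * ln t \<le> t powr (- p)"
    using assms exp_ge_add_one_self[of "- p * ln t"] by (simp add: powr_def)
  ultimately show ?thesis
    by (simp add: algebra_simps)
qed

lemma powr_plus_linear_less:
  fixes A B p m n :: real
  assumes "A > 0" and "p > 0" and "m > 0" and "n > 0" and "n \<noteq> m"
    and B: "B = p * A * m powr (- p - 1)"
  shows "A * m powr (- p) + B * m < A * n powr (- p) + B * n"
proof -
  \<comment> \<open>At the critical point the linear term is \<open>p\<close> times the power term,
    so \<open>A * m powr (- p)\<close> factors out of both sides.\<close>
  have Bm: "B * m = p * (A * m powr (- p))"
    using assms by (simp add: powr_diff)
  define t where "t = n / m"
  have t: "t > 0" "t \<noteq> 1" and n: "n = m * t"
    using assms by (auto simp: t_def)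
  have "A * m powr (- p) + B * m = A * m powr (- p) * (1 + p)"
    by (simp add: Bm algebra_simps)
  also have "\<dots> < A * m powr (- p) * (t powr (- p) + p * t)"
    using assms t powr_neg_plus_linear_gt by simp
  also have "\<dots> = A * (m powr (- p) * t powr (- p)) + B * m * t"
    by (simp add: Bm algebra_simps)
  also have "\<dots> = A * n powr (- p) + B * n"
    using assms t by (simp add: n powr_mult)
  finally show ?thesis .
qed

text \<open>Dividing by \<open>N / n\<close> contributes a factor \<open>n\<close>, which turns the
  decay \<open>n powr (- \<theta>)\<close> of the variance into
  \<open>n powr (1 - \<theta>)\<close>; the square root halves this exponent.\<close>

lemma bennett_half_width_power_variance:
  fixes \<alpha> \<sigma>\<^sub>0 \<theta> N n :: real and \<sigma> :: "real \<Rightarrow> real"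
  assumes "n > 0" and "(\<sigma> n)\<^sup>2 = \<sigma>\<^sub>0\<^sup>2 * n powr (- \<theta>)"
  shows "bennett_half_width \<sigma> \<alpha> n (N / n) =
    sqrt (2 * \<sigma>\<^sub>0\<^sup>2 * ln (2 / \<alpha>) / N) * n powr (- ((\<theta> - 1) / 2)) + ln (2 / \<alpha>) / (3 * N) * n"
proof -
  have "(1 - \<theta>) * (1 / 2) = - ((\<theta> - 1) / 2)"
    by (simp add: field_simps)
  then have "sqrt (n powr (1 - \<theta>)) = n powr (- ((\<theta> - 1) / 2))"
    by (simp only: powr_half_sqrt[OF powr_ge_zero, symmetric] powr_powr)
  moreover have "n * n powr (- \<theta>) = n powr (1 - \<theta>)"
    using assms(1) by (simp add: powr_mult_base)
  then have "2 * (\<sigma> n)\<^sup>2 * ln (2 / \<alpha>) / (N / n) =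
      2 * \<sigma>\<^sub>0\<^sup>2 * ln (2 / \<alpha>) / N * n powr (1 - \<theta>)"
    by (simp add: assms(2) mult_ac flip: times_divide_eq_right)
  ultimately show ?thesis
    by (simp only: bennett_half_width_def real_sqrt_mult) simp
qed

theorem theorem1:
  fixes \<alpha> \<sigma>\<^sub>0 \<theta> N :: real and \<sigma> H :: "real \<Rightarrow> real"
  assumes "0 < \<alpha>" and "\<alpha> < 1" and "\<sigma>\<^sub>0 > 0" and "\<theta> \<ge> 1" and "N > 0"
    and variance: "\<And>n. n > 0 \<Longrightarrow> (\<sigma> n)\<^sup>2 = \<sigma>\<^sub>0\<^sup>2 * n powr (- \<theta>)"
    and H: "\<And>n. n > 0 \<Longrightarrow> H n = bennett_half_width \<sigma> \<alpha> n (N / n)"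
  shows "(\<theta> = 1 \<longrightarrow> is_the_minimizer_on H {1..} 1) \<and>
    (\<theta> > 1 \<longrightarrow> is_the_minimizer_on H {0<..}
      ((9 * (\<theta> - 1)\<^sup>2 * \<sigma>\<^sub>0\<^sup>2 * N / (2 * ln (2 / \<alpha>))) powr (1 / (\<theta> + 1))))"
proof -
  define L where "L = ln (2 / \<alpha>)"
  define A where "A = sqrt (2 * \<sigma>\<^sub>0\<^sup>2 * L / N)"
  define B where "B = L / (3 * N)"
  define p where "p = (\<theta> - 1) / 2"
  have "L > 0"
    using assms(1,2) by (simp add: L_def)
  then have "A > 0" "B > 0"
    using assms(3,5) by (simp_all add: A_def B_def)
  have H_eq: "H n = A * n powr (- p) + B * n" if "n > 0" for n
    using that bennett_half_width_power_variance[of n \<sigma> \<sigma>\<^sub>0 \<theta>, OF that variance[OF that]]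
    by (simp add: H A_def B_def L_def p_def)
  show ?thesis
  proof (intro conjI impI)
    assume "\<theta> = 1"
    \<comment> \<open>Here \<open>p = 0\<close>, so the first term is the constant \<open>A\<close>
      and only \<open>B * n\<close> varies.\<close>
    then show "is_the_minimizer_on H {1..} 1"
      using \<open>B > 0\<close> by (intro is_the_minimizer_onI) (auto simp: H_eq p_def)
  next
    assume "\<theta> > 1"
    then have "p > 0"
      by (simp add: p_def)
    \<comment> \<open>The critical equation gives \<open>m powr (p + 1) = p * A / B\<close>. Since
      \<open>p + 1 = (\<theta> + 1) / 2\<close>, squaring yields
      \<open>m powr (\<theta> + 1) = c\<close>; the 9 comes from the 3 in the denominator of
      \<open>B\<close>.\<close>
    define c where "c = 9 * (\<theta> - 1)\<^sup>2 * \<sigma>\<^sub>0\<^sup>2 * N / (2 * L)"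
    define m where "m = c powr (1 / (\<theta> + 1))"
    have "A\<^sup>2 = 2 * \<sigma>\<^sub>0\<^sup>2 * L / N"
      using \<open>L > 0\<close> assms(3,5) by (simp add: A_def)
    then have "(p * A / B)\<^sup>2 = p\<^sup>2 * (2 * \<sigma>\<^sub>0\<^sup>2 * L / N) / B\<^sup>2"
      by (simp add: power_divide power_mult_distrib)
    also have "\<dots> = c"
      using \<open>L > 0\<close> assms(5) by (simp add: c_def p_def B_def field_simps power2_eq_square)
    finally have "(p * A / B)\<^sup>2 = c" .
    then have "sqrt c = p * A / B"
      using \<open>A > 0\<close> \<open>B > 0\<close> \<open>p > 0\<close> by (intro real_sqrt_unique) auto
    have "c > 0"
      using \<open>\<theta> > 1\<close> \<open>L > 0\<close> assms(3,5) by (simp add: c_def)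
    then have "m > 0"
      by (simp add: m_def)
    \<comment> \<open>With this exponent \<open>m powr (- p - 1)\<close> is the reciprocal of
      \<open>sqrt c = p * A / B\<close>, which is the critical equation.\<close>
    have "1 / (\<theta> + 1) * (- p - 1) = - (1 / 2)"
      using \<open>\<theta> > 1\<close> by (simp add: p_def field_simps)
    then have "m powr (- p - 1) = c powr (- (1 / 2))"
      by (simp only: m_def powr_powr)
    also have "\<dots> = inverse (sqrt c)"
      using \<open>c > 0\<close> by (simp only: powr_minus powr_half_sqrt[OF less_imp_le])
    finally have "B = p * A * m powr (- p - 1)"
      using \<open>A > 0\<close> \<open>B > 0\<close> \<open>p > 0\<close> \<open>sqrt c = p * A / B\<close> by simp
    then have "is_the_minimizer_on H {0<..} m"
      using powr_plus_linear_less \<open>A > 0\<close> \<open>p > 0\<close> \<open>m > 0\<close>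
      by (intro is_the_minimizer_onI) (simp_all add: H_eq)
    then show "is_the_minimizer_on H {0<..}
        ((9 * (\<theta> - 1)\<^sup>2 * \<sigma>\<^sub>0\<^sup>2 * N / (2 * ln (2 / \<alpha>))) powr (1 / (\<theta> + 1)))"
      by (simp add: m_def c_def L_def)
  qed
qed

end
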